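(* Let $N\geq 1$ and let $W:[0,\infty)\to\mathbb{R}\cup\{+\infty\}$ be a function such that: (1) $W$ is lower-semicontinuous; (2) the function $w(x):=W(|x|)$ is locally integrable on $\mathbb{R}^N$; (3) $W(r)\to 0$ as $r\to\infty$. Let $$E(\mu)=\int_{\mathbb{R}^N}\int_{\mathbb{R}^N} W(|x-y|)\,d\mu(x)\,d\mu(y),\qquad \mu\in\mathcal{P}(\mathbb{R}^N).$$ Then $E$ has a global minimizer in $\mathcal{P}(\mathbb{R}^N)$ (i.e. there exists $\mu_0\in\mathcal{P}(\mathbb{R}^N)$ with $E(\mu_0)\leq E(\mu)$ for all $\mu\in\mathcal{P}(\mathbb{R}^N)$) if and only if there exists a measure $\bar\mu\in\mathcal{P}(\mathbb{R}^N)$ such that $E(\bar\mu)\leq 0$.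
   Context: $\mathcal{P}(\mathbb{R}^N)$ denotes the set of Borel probability measures on $\mathbb{R}^N$, and $|\cdot|$ is the Euclidean norm. The hypotheses imply that $W$ is bounded from below, so $E$ is well defined with values in $(-\infty,+\infty]$. *)

theory Defs
  imports "HOL-Probability.Probability"
begin

definition lower_semicontinuous_on :: "'a::topological_space set \<Rightarrow> ('a \<Rightarrow> ereal) \<Rightarrow> bool" where
  "lower_semicontinuous_on S f \<longleftrightarrow> (\<forall>x\<in>S. f x \<le> Liminf (at x within S) f)"

definition locally_integrable :: "('a::euclidean_space \<Rightarrow> ereal) \<Rightarrow> bool" where
  "locally_integrable f \<longleftrightarrow>
     f \<in> borel_measurable lebesgue \<and>
     (\<forall>K. compact K \<longrightarrow> (\<integral>\<^sup>+x\<in>K. e2ennreal \<bar>f x\<bar> \<partial>lebesgue) < \<infinity>)"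

text \<open>
  The library's Lebesgue integral of extended real functions covers only nonnegative ones, so the
  general integral is the difference of the integrals of the positive and the negative part
  (\<^const>\<open>e2ennreal\<close> sends negative numbers to 0). It is meaningful when one of the two integrals
  is finite; for integrands bounded from below and finite measures the second one is.
\<close>

definition ereal_integral :: "'a measure \<Rightarrow> ('a \<Rightarrow> ereal) \<Rightarrow> ereal" where
  "ereal_integral M f =
     enn2ereal (\<integral>\<^sup>+x. e2ennreal (f x) \<partial>M) - enn2ereal (\<integral>\<^sup>+x. e2ennreal (- f x) \<partial>M)"

definition borel_prob_measures :: "'a::topological_space measure set" where
  "borel_prob_measures = {\<mu>. prob_space \<mu> \<and> sets \<mu> = sets borel}"

definition interaction_energy :: "(real \<Rightarrow> ereal) \<Rightarrow> 'a::euclidean_space measure \<Rightarrow> ereal" where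
  "interaction_energy W \<mu> =
     ereal_integral \<mu> (\<lambda>y. ereal_integral \<mu> (\<lambda>x. W (norm (x - y))))"

end

theory Submission
  imports Defs
begin

text \<open>
  Since \<open>W\<close> vanishes at infinity, mass that is spread out thinly interacts with energy close to 0:
  uniform distributions on growing balls have energies whose upper limit is at most 0, because the
  singular part of \<open>W\<close> is locally integrable and is divided by the volume of the ball. So the
  infimum of \<open>E\<close> is never positive, and a minimiser has energy at most 0.

  Conversely, let \<open>\<mu>bar\<close> have energy at most 0. If the infimum is 0, then \<open>\<mu>bar\<close> attains it.
  If the infimum is negative, mass cannot profitably escape to infinity. Splitting a
  distribution into two distant parts of masses \<open>p\<close> and \<open>q = 1 - p\<close> leaves it with energy about
  \<open>(p\<^sup>2 + q\<^sup>2) inf E\<close> at best, which is strictly worse than \<open>inf E\<close>. Made quantitative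
  (\<open>near_minimizer_concentrates\<close>), this shows that every near minimiser has almost all its mass in
  a ball whose radius depends only on the required accuracy. A minimising sequence is therefore
  tight after translations, to which the energy is blind.

  Compactness is used in the form \<open>skorohod_euclidean\<close>: a tight sequence of distributions has a
  subsequence represented by random variables that converge almost surely. Lower semicontinuity of
  the energy then reduces to Fatou's lemma (\<open>pair_energy_liminf\<close>). The multidimensional statement
  is reduced to the line by coding points of a compact set as elements of the Cantor ternary set
  with a continuous decoding map (\<open>compact_real_code\<close>).

  All estimates are carried out for the nonnegative kernel \<open>W(|x - y|) + C\<close>, where \<open>-C\<close> is a lower
  bound of \<open>W\<close>; this changes the energy of every probability measure by the constant \<open>C\<close> and
  moves the threshold from 0 to \<open>C\<close>.
\<close>

section \<open>Coding compact sets by real numbers\<close>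

text \<open>
  The digits are 0 and 2, so the values lie in the Cantor ternary set. There, unlike in binary
  expansions, two numbers that are close to each other must have the same leading digits, which
  makes decoding continuous.
\<close>

definition cantor_code :: "(nat \<Rightarrow> bool) \<Rightarrow> real" where
  "cantor_code d = (\<Sum>k. 2 * of_bool (d k) / 3 ^ Suc k)"

lemma summable_cantor_code: "summable (\<lambda>k. 2 * of_bool (d k) / 3 ^ Suc k :: real)"
proof (rule summable_comparison_test)
  show "summable (\<lambda>k. 2 / 3 * (1 / 3) ^ k :: real)"
    by (intro summable_mult summable_geometric) simp
  show "\<exists>N. \<forall>k\<ge>N. norm (2 * of_bool (d k) / 3 ^ Suc k :: real) \<le> 2 / 3 * (1 / 3) ^ k"
    by (auto simp: field_simps)
qed

lemma cantor_code_bounds: "0 \<le> cantor_code d" "cantor_code d \<le> 1"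
proof -
  show "0 \<le> cantor_code d"
    unfolding cantor_code_def by (intro suminf_nonneg summable_cantor_code) auto
  have "cantor_code d \<le> (\<Sum>k. 2 / 3 * (1 / 3) ^ k :: real)"
    unfolding cantor_code_def
    by (intro suminf_le summable_cantor_code summable_mult summable_geometric) (auto simp: field_simps)
  also have "\<dots> = 1"
    by (subst suminf_mult) (simp_all add: suminf_geometric)
  finally show "cantor_code d \<le> 1" .
qed

lemma cantor_code_Suc: "cantor_code d = (2 * of_bool (d 0) + cantor_code (\<lambda>k. d (Suc k))) / 3"
proof -
  have "cantor_code d = 2 * of_bool (d 0) / 3 + (\<Sum>k. (2 * of_bool (d (Suc k)) / 3 ^ Suc k) / 3 :: real)"
    unfolding cantor_code_def
    using suminf_split_head[OF summable_cantor_code[of d]] by (simp add: algebra_simps)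
  also have "(\<Sum>k. (2 * of_bool (d (Suc k)) / 3 ^ Suc k) / 3 :: real) = cantor_code (\<lambda>k. d (Suc k)) / 3"
    unfolding cantor_code_def by (rule suminf_divide) (rule summable_cantor_code)
  finally show ?thesis by (simp add: add_divide_distrib)
qed

lemma cantor_code_close_imp_head_eq:
  assumes "\<bar>cantor_code d - cantor_code e\<bar> < 1 / 3"
  shows "d 0 = e 0"
proof -
  have "3 * cantor_code d = 2 * of_bool (d 0) + cantor_code (\<lambda>k. d (Suc k))"
    "3 * cantor_code e = 2 * of_bool (e 0) + cantor_code (\<lambda>k. e (Suc k))"
    using cantor_code_Suc[of d] cantor_code_Suc[of e] by simp_all
  then show ?thesis
    using assms cantor_code_bounds[of "\<lambda>k. d (Suc k)"] cantor_code_bounds[of "\<lambda>k. e (Suc k)"]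
    by (cases "d 0"; cases "e 0"; simp)
qed

lemma cantor_code_close_imp_digits_eq:
  "\<bar>cantor_code d - cantor_code e\<bar> < 1 / 3 ^ Suc m \<Longrightarrow> k \<le> m \<Longrightarrow> d k = e k"
proof (induction m arbitrary: d e k)
  case 0
  then show ?case
    using cantor_code_close_imp_head_eq[of d e] by simp
next
  case (Suc m)
  have "1 / 3 ^ Suc (Suc m) \<le> (1 / 3 :: real)"
    using one_le_power[of "3::real" m] by (simp add: field_simps del: one_le_power)
  then have d0: "d 0 = e 0"
    using Suc.prems(1) by (intro cantor_code_close_imp_head_eq) (rule order.strict_trans2)
  have "\<bar>cantor_code (\<lambda>k. d (Suc k)) - cantor_code (\<lambda>k. e (Suc k))\<bar> < 1 / 3 ^ Suc m"
  proof -
    have *: "cantor_code d - cantor_code e = (cantor_code (\<lambda>k. d (Suc k)) - cantor_code (\<lambda>k. e (Suc k))) / 3"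
      unfolding cantor_code_Suc[of d] cantor_code_Suc[of e] d0 by (simp add: diff_divide_distrib add_divide_distrib)
    then show ?thesis
      using Suc.prems(1) unfolding * by (simp add: abs_divide)
  qed
  from Suc.IH[OF this] Suc.prems(2) d0 show ?case
    by (cases k) auto
qed

text \<open>
  A compact set is a continuous image of a bounded set of reals, with a Borel right inverse: a point is coded by recording in
  which members of a countable base of open sets it lies, as the digits of a Cantor number.
  Decoding is uniformly continuous because, by compactness, finitely many small basic sets cover
  \<open>K\<close>, and two points whose codes agree in the corresponding digits lie in a common one.
  So the decoding map extends continuously to the closure of the set of codes and then, by
  Dugundji's theorem, to the whole line. The coding map \<open>\<sigma>\<close> itself is only Borel.
\<close>

lemma compact_real_code:
  fixes K :: "'a::euclidean_space set"
  assumes "compact K"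
  obtains \<sigma> :: "'a \<Rightarrow> real" and \<phi> :: "real \<Rightarrow> 'a" where
    "\<sigma> \<in> borel_measurable borel" "\<And>x. 0 \<le> \<sigma> x" "\<And>x. \<sigma> x \<le> 1"
    "continuous_on UNIV \<phi>" "\<And>x. x \<in> K \<Longrightarrow> \<phi> (\<sigma> x) = x"
proof -
  obtain \<B> :: "'a set set" where \<B>: "countable \<B>" "topological_basis \<B>"
    using ex_countable_basis by blast
  have \<B>_ne: "\<B> \<noteq> {}"
    using topological_basisE[OF \<B>(2) open_UNIV UNIV_I] by blast
  define B where "B = from_nat_into \<B>"
  have B_range: "range B = \<B>"
    unfolding B_def by (rule range_from_nat_into[OF \<B>_ne \<B>(1)])
  have B_open: "open (B k)" for k
    using B_range topological_basis_open[OF \<B>(2)] by blast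
  define \<sigma> where "\<sigma> x = cantor_code (\<lambda>k. x \<in> B k)" for x
  have sep: "\<exists>\<delta>>0. \<forall>x\<in>K. \<forall>y\<in>K. \<bar>\<sigma> x - \<sigma> y\<bar> < \<delta> \<longrightarrow> dist x y < \<epsilon>" if "\<epsilon> > 0" for \<epsilon>
  proof -
    have "\<exists>k. x \<in> B k \<and> B k \<subseteq> ball x (\<epsilon> / 2)" for x
      using topological_basisE[OF \<B>(2) open_ball, of x x "\<epsilon> / 2"] that B_range
      by (metis centre_in_ball half_gt_zero rangeE)
    then obtain k where k: "\<And>x. x \<in> B (k x) \<and> B (k x) \<subseteq> ball x (\<epsilon> / 2)"
      by metis
    obtain C where C: "C \<subseteq> K" "finite C" "K \<subseteq> (\<Union>c\<in>C. B (k c))"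
      using compactE_image[OF assms, of K "\<lambda>x. B (k x)"] B_open k by blast
    obtain m where m: "\<And>c. c \<in> C \<Longrightarrow> k c \<le> m"
      using finite_nat_set_iff_bounded_le[of "k ` C"] C(2) by auto
    \<comment> \<open>at this distance the codes agree in all digits up to \<open>m\<close>, hence in all that the cover uses\<close>
    show ?thesis
    proof (intro exI[of _ "1 / 3 ^ Suc m"] conjI ballI impI)
      fix x y assume xy: "x \<in> K" "y \<in> K" "\<bar>\<sigma> x - \<sigma> y\<bar> < 1 / 3 ^ Suc m"
      obtain c where c: "c \<in> C" "x \<in> B (k c)"
        using C(3) xy(1) by blast
      have "y \<in> B (k c)"
        using cantor_code_close_imp_digits_eq[OF xy(3)[unfolded \<sigma>_def] m[OF c(1)]] c(2) by simp
      with c k[of c] have "dist c x < \<epsilon> / 2" "dist c y < \<epsilon> / 2"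
        by auto
      then show "dist x y < \<epsilon>"
        by (metis dist_commute dist_triangle_half_l)
    qed simp
  qed
  have inj: "inj_on \<sigma> K"
  proof (rule inj_onI, rule ccontr)
    fix x y assume xy: "x \<in> K" "y \<in> K" "\<sigma> x = \<sigma> y" "x \<noteq> y"
    then obtain \<delta> where "\<delta> > 0"
      "\<And>u v. u \<in> K \<Longrightarrow> v \<in> K \<Longrightarrow> \<bar>\<sigma> u - \<sigma> v\<bar> < \<delta> \<Longrightarrow> dist u v < dist x y"
      using sep[of "dist x y"] by auto
    from this(2)[OF xy(1,2)] this(1) xy(3) show False
      by simp
  qed
  have "uniformly_continuous_on (\<sigma> ` K) (inv_into K \<sigma>)"
    unfolding uniformly_continuous_on_def using sep
    by (simp add: inv_into_f_f[OF inj] dist_real_def abs_minus_commute dist_commute)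
  then obtain g where g: "uniformly_continuous_on (closure (\<sigma> ` K)) g"
    "\<And>s. s \<in> \<sigma> ` K \<Longrightarrow> inv_into K \<sigma> s = g s"
    by (rule uniformly_continuous_on_extension_on_closure) (rule that, assumption, meson)
  have "closedin (top_of_set UNIV) (closure (\<sigma> ` K))"
    by simp
  then obtain \<phi> where \<phi>: "continuous_on UNIV \<phi>" "\<And>s. s \<in> closure (\<sigma> ` K) \<Longrightarrow> \<phi> s = g s"
    by (rule Dugundji[OF convex_UNIV UNIV_not_empty _ uniformly_continuous_imp_continuous[OF g(1)] subset_UNIV]) blast
  have [measurable]: "B k \<in> sets borel" for k
    using B_open by simp
  show thesis
  proof
    show "\<sigma> \<in> borel_measurable borel"
      unfolding \<sigma>_def cantor_code_def by measurable
    show "\<phi> (\<sigma> x) = x" if "x \<in> K" for x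
      using that \<phi>(2) g(2)[of "\<sigma> x"] closure_subset[of "\<sigma> ` K"] inv_into_f_f[OF inj that] by auto
  qed (auto simp: \<sigma>_def cantor_code_bounds \<phi>)
qed

section \<open>Almost surely convergent representations of tight sequences\<close>

text \<open>
  Prokhorov's theorem and Skorohod's representation theorem in one, obtained by transport from
  the line. Squeeze the space into the unit ball by \<open>h\<close>, and code the closed ball by reals in the
  unit interval. The laws of the codes live on a bounded interval, so they have a weakly convergent
  subsequence and a Skorohod representation by real random variables; decoding preserves
  convergence because the decoding map is continuous. Tightness enters only at the end: it keeps
  the limit off the boundary sphere, so that \<open>h\<close> can be undone in the limit.
\<close>

lemma skorohod_euclidean:
  fixes \<mu> :: "nat \<Rightarrow> 'a::euclidean_space measure"
  assumes prob: "\<And>n. prob_space (\<mu> n)" and sets_\<mu>: "\<And>n. sets (\<mu> n) = sets borel"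
    and tight: "\<And>\<epsilon>. \<epsilon> > 0 \<Longrightarrow> \<exists>R. \<forall>\<^sub>F n in sequentially. measure (\<mu> n) (- cball 0 R) \<le> \<epsilon>"
  obtains r :: "nat \<Rightarrow> nat" and \<Omega> :: "real measure" and X :: "nat \<Rightarrow> real \<Rightarrow> 'a" and X\<^sub>0 :: "real \<Rightarrow> 'a"
  where "strict_mono r" "prob_space \<Omega>"
    "\<And>n. X n \<in> borel_measurable \<Omega>" "\<And>n. distr \<Omega> borel (X n) = \<mu> (r n)"
    "X\<^sub>0 \<in> borel_measurable \<Omega>" "AE \<omega> in \<Omega>. (\<lambda>n. X n \<omega>) \<longlonglongrightarrow> X\<^sub>0 \<omega>"
proof -
  note [measurable_cong] = sets_\<mu>
  \<comment> \<open>\<open>h\<close> is a homeomorphism onto the open unit ball, with inverse \<open>k\<close>\<close>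
  define h :: "'a \<Rightarrow> 'a" where "h x = x /\<^sub>R (1 + norm x)" for x
  define k :: "'a \<Rightarrow> 'a" where "k z = z /\<^sub>R (1 - norm z)" for z
  have norm_h: "norm (h x) = norm x / (1 + norm x)" for x
    by (simp add: h_def field_simps)
  have k_h: "k (h x) = x" for x
  proof -
    have "1 - t / (1 + t) = inverse (1 + t)" if "t \<ge> 0" for t :: real
      using that by (simp add: field_simps)
    then have "1 - norm (h x) = inverse (1 + norm x)"
      unfolding norm_h by simp
    then show ?thesis
      unfolding k_def using add_pos_nonneg[OF zero_less_one norm_ge_zero[of x]]
      by (simp add: h_def)
  qed
  have h_ball: "h x \<in> cball 0 1" for x
    using add_pos_nonneg[OF zero_less_one norm_ge_zero[of x]] by (simp add: norm_h divide_le_eq_1_pos)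
  obtain \<sigma> and \<phi> :: "real \<Rightarrow> 'a" where
    \<sigma>[measurable]: "\<sigma> \<in> borel_measurable borel" and \<sigma>_bounds: "\<And>x. 0 \<le> \<sigma> x" "\<And>x. \<sigma> x \<le> 1"
    and \<phi>: "continuous_on UNIV \<phi>" and \<phi>_\<sigma>: "\<And>x. x \<in> cball 0 1 \<Longrightarrow> \<phi> (\<sigma> x) = x"
    using compact_real_code[of "cball 0 1 :: 'a set"] by auto
  have [measurable]: "\<phi> \<in> borel_measurable borel"
    using \<phi> by (rule borel_measurable_continuous_onI)
  have [measurable]: "h \<in> borel_measurable borel" "k \<in> borel_measurable borel"
    unfolding h_def[abs_def] k_def[abs_def] by measurable
  define \<nu> where "\<nu> n = distr (\<mu> n) borel (\<lambda>x. \<sigma> (h x))" for n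
  have \<nu>: "real_distribution (\<nu> n)" for n
    unfolding \<nu>_def using prob by (intro prob_space.real_distribution_distr) auto
  have "measure (\<nu> n) {-1<..1} = 1" for n
  proof -
    have "measure (\<nu> n) {-1<..1} = measure (\<mu> n) (space (\<mu> n))"
      unfolding \<nu>_def using \<sigma>_bounds
      by (subst measure_distr)
         (auto intro!: arg_cong[where f="measure (\<mu> n)"] simp: less_le_trans[of "-1::real" 0])
    then show ?thesis
      using prob_space.prob_space[OF prob] by simp
  qed
  then have *: "(-1::real) < 1 \<and> (\<forall>n. 1 - \<epsilon> < measure (\<nu> n) {-1<..1})" if "\<epsilon> > 0" for \<epsilon>
    using that by simp
  have "tight \<nu>"
    unfolding tight_def using \<nu> * by blast
  from tight_imp_convergent_subsubsequence[OF this strict_mono_id] obtain r M where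
    r: "strict_mono r" and M: "real_distribution M" and conv: "weak_conv_m (\<lambda>n. \<nu> (r n)) M"
    by (auto simp: comp_def)
  obtain \<Omega> :: "real measure" and Y Y\<^sub>0 where \<Omega>: "prob_space \<Omega>"
    and Y[measurable]: "\<And>n. Y n \<in> borel_measurable \<Omega>" and Y_distr: "\<And>n. distr \<Omega> borel (Y n) = \<nu> (r n)"
    and Y\<^sub>0': "Y\<^sub>0 \<in> measurable \<Omega> lborel" and Y_lim: "\<And>\<omega>. \<omega> \<in> space \<Omega> \<Longrightarrow> (\<lambda>n. Y n \<omega>) \<longlonglongrightarrow> Y\<^sub>0 \<omega>"
    using Skorohod[OF \<nu> M conv] by blast
  interpret \<Omega>: prob_space \<Omega> by fact
  have Y\<^sub>0[measurable]: "Y\<^sub>0 \<in> borel_measurable \<Omega>"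
    using Y\<^sub>0' by simp
  have \<phi>\<sigma>h: "\<phi> (\<sigma> (h x)) = h x" for x
    using \<phi>_\<sigma>[OF h_ball] .
  have law: "distr \<Omega> borel (\<lambda>\<omega>. g (\<phi> (Y n \<omega>))) = distr (\<mu> (r n)) borel (\<lambda>x. g (h x))"
    if [measurable]: "g \<in> borel_measurable borel" for n and g :: "'a \<Rightarrow> 'a"
  proof -
    have "distr \<Omega> borel (\<lambda>\<omega>. g (\<phi> (Y n \<omega>))) = distr (distr \<Omega> borel (Y n)) borel (\<lambda>y. g (\<phi> y))"
      by (subst distr_distr) (auto simp: comp_def)
    also have "\<dots> = distr (\<mu> (r n)) borel (\<lambda>x. g (h x))"
      unfolding Y_distr \<nu>_def by (subst distr_distr) (auto simp: comp_def \<phi>\<sigma>h)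
    finally show ?thesis .
  qed
  have lim: "(\<lambda>n. \<phi> (Y n \<omega>)) \<longlonglongrightarrow> \<phi> (Y\<^sub>0 \<omega>)" if "\<omega> \<in> space \<Omega>" for \<omega>
    using \<phi> Y_lim[OF that] by (auto intro!: continuous_on_tendsto_compose[of UNIV \<phi>])
  have small: "measure \<Omega> {\<omega>\<in>space \<Omega>. 1 \<le> norm (\<phi> (Y\<^sub>0 \<omega>))} \<le> \<epsilon>" if \<epsilon>: "\<epsilon> > 0" for \<epsilon>
  proof -
    obtain R' where R': "\<forall>\<^sub>F n in sequentially. measure (\<mu> n) (- cball 0 R') \<le> \<epsilon>"
      using tight[OF \<epsilon>] by blast
    define R where "R = max R' 0"
    have R: "R \<ge> 0" and tail: "\<forall>\<^sub>F n in sequentially. measure (\<mu> (r n)) (- cball 0 R) \<le> \<epsilon>"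
    proof -
      show "R \<ge> 0" by (simp add: R_def)
      have "measure (\<mu> n) (- cball 0 R) \<le> measure (\<mu> n) (- cball 0 R')" for n
      proof -
        interpret prob_space "\<mu> n" by (rule prob)
        show ?thesis by (rule finite_measure_mono) (auto simp: R_def)
      qed
      with R' have "\<forall>\<^sub>F n in sequentially. measure (\<mu> n) (- cball 0 R) \<le> \<epsilon>"
        by (auto elim!: eventually_mono intro: order_trans)
      then show "\<forall>\<^sub>F n in sequentially. measure (\<mu> (r n)) (- cball 0 R) \<le> \<epsilon>"
        by (rule eventually_subseq[OF r])
    qed
    define s where "s = R / (1 + R)"
    have s: "s < 1" using R by (simp add: s_def)
    let ?U = "- cball (0::'a) s"
    have "R / (1 + R) < t / (1 + t) \<longleftrightarrow> R < t" if "t \<ge> 0" for t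
      using R that by (simp add: field_simps)
    then have "norm (h x) > s \<longleftrightarrow> norm x > R" for x
      unfolding s_def norm_h by simp
    then have hU: "h x \<in> ?U \<longleftrightarrow> x \<in> - cball 0 R" for x
      by (simp add: not_le)
    have mass: "(\<integral>\<^sup>+\<omega>. indicator ?U (\<phi> (Y n \<omega>)) \<partial>\<Omega>) = measure (\<mu> (r n)) (- cball 0 R)" for n
    proof -
      have "(\<integral>\<^sup>+\<omega>. indicator ?U (\<phi> (Y n \<omega>)) \<partial>\<Omega>) = (\<integral>\<^sup>+z. indicator ?U z \<partial>distr \<Omega> borel (\<lambda>\<omega>. \<phi> (Y n \<omega>)))"
        by (subst nn_integral_distr) auto
      also have "\<dots> = (\<integral>\<^sup>+z. indicator ?U z \<partial>distr (\<mu> (r n)) borel h)"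
        using law[of "\<lambda>x. x" n] by simp
      also have "\<dots> = (\<integral>\<^sup>+x. indicator ?U (h x) \<partial>\<mu> (r n))"
        by (rule nn_integral_distr) measurable
      also have "\<dots> = (\<integral>\<^sup>+x. indicator (- cball 0 R) x \<partial>\<mu> (r n))"
        by (intro nn_integral_cong) (simp only: indicator_def hU)
      finally show ?thesis
        using prob_space.finite_measure[OF prob[of "r n"]]
        by (simp add: finite_measure.emeasure_eq_measure)
    qed
    have "ennreal (measure \<Omega> {\<omega>\<in>space \<Omega>. 1 \<le> norm (\<phi> (Y\<^sub>0 \<omega>))}) =
        (\<integral>\<^sup>+\<omega>. indicator {\<omega>\<in>space \<Omega>. 1 \<le> norm (\<phi> (Y\<^sub>0 \<omega>))} \<omega> \<partial>\<Omega>)"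
      by (simp add: \<Omega>.emeasure_eq_measure)
    \<comment> \<open>\<open>?U\<close> is open and contains the sphere, so a limit on the sphere forces \<open>?U\<close> to be entered\<close>
    also have "\<dots> \<le> (\<integral>\<^sup>+\<omega>. liminf (\<lambda>n. indicator ?U (\<phi> (Y n \<omega>))) \<partial>\<Omega>)"
    proof (intro nn_integral_mono)
      fix \<omega> assume \<omega>: "\<omega> \<in> space \<Omega>"
      show "indicator {\<omega>\<in>space \<Omega>. 1 \<le> norm (\<phi> (Y\<^sub>0 \<omega>))} \<omega> \<le> liminf (\<lambda>n. indicator ?U (\<phi> (Y n \<omega>)) :: ennreal)"
      proof (cases "1 \<le> norm (\<phi> (Y\<^sub>0 \<omega>))")
        case True
        then have "\<phi> (Y\<^sub>0 \<omega>) \<in> ?U" using s by simp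
        then have "\<forall>\<^sub>F n in sequentially. \<phi> (Y n \<omega>) \<in> ?U"
          by (rule topological_tendstoD[OF lim[OF \<omega>], rotated]) auto
        then have "1 \<le> liminf (\<lambda>n. indicator ?U (\<phi> (Y n \<omega>)) :: ennreal)"
          by (intro Liminf_bounded) (auto elim!: eventually_mono)
        then show ?thesis using \<omega> True by simp
      qed simp
    qed
    also have "\<dots> \<le> liminf (\<lambda>n. \<integral>\<^sup>+\<omega>. indicator ?U (\<phi> (Y n \<omega>)) \<partial>\<Omega>)"
      by (rule nn_integral_liminf) measurable
    also have "\<dots> \<le> ennreal \<epsilon>"
      unfolding mass using tail
      by (intro order_trans[OF Liminf_le_Limsup Limsup_bounded]) (auto elim!: eventually_mono intro: ennreal_leI)
    finally show ?thesis
      using \<epsilon> by (simp add: ennreal_le_iff)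
  qed
  have "AE \<omega> in \<Omega>. norm (\<phi> (Y\<^sub>0 \<omega>)) < 1"
  proof -
    have "measure \<Omega> {\<omega>\<in>space \<Omega>. 1 \<le> norm (\<phi> (Y\<^sub>0 \<omega>))} = 0"
    proof (rule ccontr)
      assume "measure \<Omega> {\<omega>\<in>space \<Omega>. 1 \<le> norm (\<phi> (Y\<^sub>0 \<omega>))} \<noteq> 0" (is "?p \<noteq> 0")
      then have "?p > 0"
        using zero_less_measure_iff by blast
      with small[of "?p / 2"] show False
        by simp
    qed
    then have "AE \<omega> in \<Omega>. \<not> 1 \<le> norm (\<phi> (Y\<^sub>0 \<omega>))"
      by (intro AE_I[where N="{\<omega>\<in>space \<Omega>. 1 \<le> norm (\<phi> (Y\<^sub>0 \<omega>))}"]) (auto simp: \<Omega>.emeasure_eq_measure)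
    then show ?thesis by (simp add: not_le)
  qed
  then have "AE \<omega> in \<Omega>. (\<lambda>n. k (\<phi> (Y n \<omega>))) \<longlonglongrightarrow> k (\<phi> (Y\<^sub>0 \<omega>))"
  proof (rule AE_mp, intro AE_I2 impI)
    fix \<omega> assume "\<omega> \<in> space \<Omega>" "norm (\<phi> (Y\<^sub>0 \<omega>)) < 1"
    then show "(\<lambda>n. k (\<phi> (Y n \<omega>))) \<longlonglongrightarrow> k (\<phi> (Y\<^sub>0 \<omega>))"
      unfolding k_def by (intro tendsto_intros lim) auto
  qed
  moreover have "distr \<Omega> borel (\<lambda>\<omega>. k (\<phi> (Y n \<omega>))) = \<mu> (r n)" for n
    using law[of k n] by (simp add: k_h distr_id2 sets_\<mu>)
  ultimately show thesis
    by (intro that[OF r \<Omega>, of "\<lambda>n \<omega>. k (\<phi> (Y n \<omega>))" "\<lambda>\<omega>. k (\<phi> (Y\<^sub>0 \<omega>))"]) auto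
qed

section \<open>Pair energies of nonnegative kernels\<close>

definition pair_energy :: "('a \<Rightarrow> 'a \<Rightarrow> ennreal) \<Rightarrow> 'a measure \<Rightarrow> ennreal" where
  "pair_energy V \<mu> = (\<integral>\<^sup>+y. \<integral>\<^sup>+x. V x y \<partial>\<mu> \<partial>\<mu>)"

text \<open>
  Energy is quadratic in mass: this is the lower bound \<open>j\<close> applied to the restriction of
  \<open>\<mu>\<close> to \<open>P\<close>, normalised to a probability measure.
\<close>

lemma pair_energy_restrict_ge:
  assumes "prob_space \<mu>" and V: "case_prod V \<in> borel_measurable (\<mu> \<Otimes>\<^sub>M \<mu>)" and P[measurable]: "P \<in> sets \<mu>"
    and inf: "\<And>\<nu>. prob_space \<nu> \<Longrightarrow> sets \<nu> = sets \<mu> \<Longrightarrow> j \<le> pair_energy V \<nu>"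
  shows "j * emeasure \<mu> P * emeasure \<mu> P \<le> (\<integral>\<^sup>+y. \<integral>\<^sup>+x. V x y * indicator P x * indicator P y \<partial>\<mu> \<partial>\<mu>)"
proof (cases "emeasure \<mu> P = 0")
  case False
  interpret prob_space \<mu> by fact
  have fin: "emeasure \<mu> P \<noteq> \<infinity>" by simp
  have [measurable]: "(\<lambda>(y, x). V x y) \<in> borel_measurable (\<mu> \<Otimes>\<^sub>M \<mu>)"
    using measurable_compose[OF measurable_pair_swap' V] by (simp add: case_prod_beta')
  let ?\<nu> = "uniform_measure \<mu> P"
  have [measurable]: "(\<lambda>x. V x y) \<in> borel_measurable \<mu>" if "y \<in> space \<mu>" for y
    using measurable_compose[OF measurable_Pair1' V] that by simp
  have "j \<le> pair_energy V ?\<nu>"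
    using prob_space_uniform_measure[OF False fin] by (intro inf) simp_all
  also have "pair_energy V ?\<nu> = (\<integral>\<^sup>+y. (\<integral>\<^sup>+x. V x y * indicator P x \<partial>\<mu>) / emeasure \<mu> P \<partial>?\<nu>)"
    unfolding pair_energy_def by (intro nn_integral_cong nn_integral_uniform_measure) auto
  also have "\<dots> = (\<integral>\<^sup>+y. (\<integral>\<^sup>+x. V x y * indicator P x \<partial>\<mu>) / emeasure \<mu> P * indicator P y \<partial>\<mu>) / emeasure \<mu> P"
    by (intro nn_integral_uniform_measure) measurable
  also have "(\<integral>\<^sup>+y. (\<integral>\<^sup>+x. V x y * indicator P x \<partial>\<mu>) / emeasure \<mu> P * indicator P y \<partial>\<mu>)
      = (\<integral>\<^sup>+y. (\<integral>\<^sup>+x. V x y * indicator P x * indicator P y \<partial>\<mu>) / emeasure \<mu> P \<partial>\<mu>)"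
  proof (intro nn_integral_cong)
    fix y assume [simp]: "y \<in> space \<mu>"
    have "(\<integral>\<^sup>+x. V x y * indicator P x * indicator P y \<partial>\<mu>) = (\<integral>\<^sup>+x. V x y * indicator P x \<partial>\<mu>) * indicator P y"
      by (intro nn_integral_multc) simp
    then show "(\<integral>\<^sup>+x. V x y * indicator P x \<partial>\<mu>) / emeasure \<mu> P * indicator P y
        = (\<integral>\<^sup>+x. V x y * indicator P x * indicator P y \<partial>\<mu>) / emeasure \<mu> P"
      by (simp add: ennreal_divide_times ennreal_times_divide)
  qed
  also have "\<dots> = (\<integral>\<^sup>+y. \<integral>\<^sup>+x. V x y * indicator P x * indicator P y \<partial>\<mu> \<partial>\<mu>) / emeasure \<mu> P"
    by (intro nn_integral_divide) measurable
  finally have "j \<le> (\<integral>\<^sup>+y. \<integral>\<^sup>+x. V x y * indicator P x * indicator P y \<partial>\<mu> \<partial>\<mu>) / emeasure \<mu> P / emeasure \<mu> P"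
    (is "j \<le> ?S / _ / _") .
  then have "j * emeasure \<mu> P * emeasure \<mu> P \<le> ?S / emeasure \<mu> P / emeasure \<mu> P * emeasure \<mu> P * emeasure \<mu> P"
    by (intro mult_right_mono) simp_all
  moreover have "a / emeasure \<mu> P * emeasure \<mu> P = a" for a
    using False fin by (simp add: ennreal_divide_times less_top[symmetric])
  ultimately show ?thesis
    by simp
qed simp

text \<open>
  Of the four blocks of \<open>(P \<union> Q) \<times> (P \<union> Q)\<close>, the diagonal ones obey the lower bound \<open>j\<close> scaled by
  the squared masses, and the other two the pointwise bound \<open>e\<close>. What \<open>\<mu>\<close> has outside
  \<open>P \<union> Q\<close> can only add energy, since \<open>V\<close> is nonnegative.
\<close>

lemma pair_energy_split:
  assumes "prob_space \<mu>" and V: "case_prod V \<in> borel_measurable (\<mu> \<Otimes>\<^sub>M \<mu>)"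
    and P[measurable]: "P \<in> sets \<mu>" and Q[measurable]: "Q \<in> sets \<mu>" and disj: "P \<inter> Q = {}"
    and inf: "\<And>\<nu>. prob_space \<nu> \<Longrightarrow> sets \<nu> = sets \<mu> \<Longrightarrow> ennreal j \<le> pair_energy V \<nu>"
    and far: "\<And>x y. x \<in> P \<Longrightarrow> y \<in> Q \<Longrightarrow> ennreal e \<le> V x y \<and> ennreal e \<le> V y x"
    and "0 \<le> j" "0 \<le> e"
  shows "ennreal (j * (measure \<mu> P)\<^sup>2 + j * (measure \<mu> Q)\<^sup>2 + 2 * e * measure \<mu> P * measure \<mu> Q) \<le> pair_energy V \<mu>"
proof -
  interpret prob_space \<mu> by fact
  have [measurable]: "(\<lambda>(y, x). V x y) \<in> borel_measurable (\<mu> \<Otimes>\<^sub>M \<mu>)"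
    using measurable_compose[OF measurable_pair_swap' V] by (simp add: case_prod_beta')
  have [measurable]: "(\<lambda>x. V x y) \<in> borel_measurable \<mu>" if "y \<in> space \<mu>" for y
    using measurable_compose[OF measurable_Pair1' V] that by simp
  let ?PP = "\<lambda>x y. V x y * indicator P x * indicator P y"
  let ?QQ = "\<lambda>x y. V x y * indicator Q x * indicator Q y"
  let ?PQ = "\<lambda>x y. ennreal e * indicator P x * indicator Q y"
  let ?QP = "\<lambda>x y. ennreal e * indicator Q x * indicator P y"
  have "ennreal (j * (measure \<mu> P)\<^sup>2 + j * (measure \<mu> Q)\<^sup>2 + 2 * e * measure \<mu> P * measure \<mu> Q)
    = ennreal j * emeasure \<mu> P * emeasure \<mu> P + ennreal j * emeasure \<mu> Q * emeasure \<mu> Q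
      + (ennreal e * emeasure \<mu> P * emeasure \<mu> Q + ennreal e * emeasure \<mu> Q * emeasure \<mu> P)"
    using assms(8,9)
    by (simp add: emeasure_eq_measure ennreal_mult[symmetric] ennreal_plus[symmetric] power2_eq_square
        algebra_simps del: ennreal_plus)
  also have "\<dots> \<le> (\<integral>\<^sup>+y. \<integral>\<^sup>+x. ?PP x y \<partial>\<mu> \<partial>\<mu>) + (\<integral>\<^sup>+y. \<integral>\<^sup>+x. ?QQ x y \<partial>\<mu> \<partial>\<mu>)
      + ((\<integral>\<^sup>+y. \<integral>\<^sup>+x. ?PQ x y \<partial>\<mu> \<partial>\<mu>) + (\<integral>\<^sup>+y. \<integral>\<^sup>+x. ?QP x y \<partial>\<mu> \<partial>\<mu>))"
    by (intro add_mono pair_energy_restrict_ge[OF assms(1) V _ inf])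
       (auto simp: nn_integral_multc nn_integral_cmult mult_ac)
  also have "\<dots> = (\<integral>\<^sup>+y. \<integral>\<^sup>+x. ?PP x y + ?QQ x y + (?PQ x y + ?QP x y) \<partial>\<mu> \<partial>\<mu>)"
  proof -
    have "(\<integral>\<^sup>+x. ?PP x y + ?QQ x y + (?PQ x y + ?QP x y) \<partial>\<mu>) =
        (\<integral>\<^sup>+x. ?PP x y \<partial>\<mu>) + (\<integral>\<^sup>+x. ?QQ x y \<partial>\<mu>) + ((\<integral>\<^sup>+x. ?PQ x y \<partial>\<mu>) + (\<integral>\<^sup>+x. ?QP x y \<partial>\<mu>))"
      if "y \<in> space \<mu>" for y
      using that by (simp add: nn_integral_add)
    then show ?thesis
      by (simp add: nn_integral_add cong: nn_integral_cong)
  qed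
  also have "\<dots> \<le> pair_energy V \<mu>"
    unfolding pair_energy_def using disj far
    by (intro nn_integral_mono) (auto simp: indicator_def)
  finally show ?thesis .
qed

section \<open>Concentration of near minimisers\<close>

text \<open>
  This replaces the exclusion of vanishing and dichotomy in the concentration-compactness method
  by an explicit estimate. Here \<open>j\<close> is a lower bound for the energy of every probability
  measure, and the kernel exceeds it by at least \<open>g / 2\<close> at distances from \<open>L\<close> on.

  No vanishing: some point \<open>y\<close> has potential below \<open>j + g / 4\<close>, while mass at distance at least
  \<open>L\<close> from \<open>y\<close> contributes at least \<open>j + g / 2\<close> per unit; so a fixed fraction of the mass lies
  within distance \<open>L\<close> of \<open>y\<close>.

  No dichotomy: among \<open>K\<close> successive annuli of width \<open>L\<close> around \<open>y\<close>, one has mass at most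
  \<open>1 / K\<close>. Let \<open>p\<close> and \<open>q\<close> be the masses inside and outside that annulus. They are \<open>L\<close> apart, so
  the energy is at least \<open>j (p\<^sup>2 + q\<^sup>2) + 2 (j + g / 2) p q = j (p + q)\<^sup>2 + g p q\<close> with
  \<open>p + q \<ge> 1 - 1 / K\<close>. For a near minimiser this makes \<open>g p q\<close> small, and \<open>p\<close> is bounded
  away from 0.
\<close>

lemma near_minimizer_concentrates:
  fixes \<mu> :: "'a::euclidean_space measure"
  assumes "prob_space \<mu>" and sets_\<mu>[measurable_cong]: "sets \<mu> = sets borel"
    and V[measurable]: "case_prod V \<in> borel_measurable (borel \<Otimes>\<^sub>M borel)"
    and inf: "\<And>\<nu>. prob_space \<nu> \<Longrightarrow> sets \<nu> = sets \<mu> \<Longrightarrow> ennreal j \<le> pair_energy V \<nu>"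
    and far: "\<And>x y. L \<le> dist x y \<Longrightarrow> ennreal (j + g / 2) \<le> V x y"
    and "0 \<le> j" "0 < g" "0 < L" "\<delta> < g / 4" "0 \<le> \<delta>"
    and energy: "pair_energy V \<mu> \<le> ennreal (j + \<delta>)"
  shows "\<exists>y. \<forall>K\<ge>1::nat. measure \<mu> (- cball y (L * (real K + 1)))
           \<le> 4 * (j + g / 2) / g\<^sup>2 * (\<delta> + 2 * j / K)"
proof -
  interpret prob_space \<mu> by fact
  have V'[measurable]: "case_prod V \<in> borel_measurable (\<mu> \<Otimes>\<^sub>M \<mu>)"
    by measurable
  have "\<exists>y. (\<integral>\<^sup>+x. V x y \<partial>\<mu>) < ennreal (j + g / 4)"
  proof (rule ccontr)
    assume "\<not> ?thesis"
    then have "(\<integral>\<^sup>+y. ennreal (j + g / 4) \<partial>\<mu>) \<le> pair_energy V \<mu>"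
      unfolding pair_energy_def by (intro nn_integral_mono) (auto simp: not_less)
    with energy have "ennreal (j + g / 4) \<le> ennreal (j + \<delta>)"
      by (simp add: emeasure_space_1)
    then show False
      using assms by (subst (asm) ennreal_le_iff) auto
  qed
  then obtain y where y: "(\<integral>\<^sup>+x. V x y \<partial>\<mu>) < ennreal (j + g / 4)"
    by blast
  define m where "m r = measure \<mu> (ball y r)" for r
  have m_mono: "m r \<le> m s" if "r \<le> s" for r s
    unfolding m_def using that by (intro finite_measure_mono) auto
  have m_bounds: "0 \<le> m r" "m r \<le> 1" for r
    by (auto simp: m_def)
  have compl: "measure \<mu> (- ball y r) = 1 - m r" for r
    using prob_compl[of "ball y r"] sets_eq_imp_space_eq[OF sets_\<mu>] by (simp add: m_def Compl_eq_Diff_UNIV)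
  have "g / 4 \<le> m L * (j + g / 2)"
  proof -
    have "ennreal ((j + g / 2) * (1 - m L)) = (\<integral>\<^sup>+x. ennreal (j + g / 2) * indicator (- ball y L) x \<partial>\<mu>)"
      using assms m_bounds[of L]
      by (simp add: nn_integral_cmult emeasure_eq_measure compl ennreal_mult[symmetric] del: ennreal_plus)
    also have "\<dots> \<le> (\<integral>\<^sup>+x. V x y \<partial>\<mu>)"
      using far by (intro nn_integral_mono) (auto simp: indicator_def dist_commute not_less)
    also have "\<dots> \<le> ennreal (j + g / 4)"
      using y by simp
    finally have "(j + g / 2) * (1 - m L) \<le> j + g / 4"
      using assms by (subst (asm) ennreal_le_iff) auto
    then show ?thesis
      by (simp add: algebra_simps)
  qed
  moreover have jg: "0 < j + g / 2"
    using assms by simp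
  ultimately have m_ge: "g / (4 * (j + g / 2)) \<le> m L"
    by (simp add: field_simps)
  show ?thesis
  proof (intro exI[of _ y] allI impI)
    fix K :: nat assume K: "1 \<le> K"
    define R where "R i = L * (real i + 1)" for i :: nat
    have R_Suc: "R (Suc i) = R i + L" and R_ge: "L \<le> R i" for i
      using \<open>0 < L\<close> by (auto simp: R_def algebra_simps)
    have "\<exists>i<K. m (R (Suc i)) - m (R i) \<le> 1 / K"
    proof (rule ccontr)
      assume "\<not> ?thesis"
      then have "(\<Sum>i<K. 1 / K) < (\<Sum>i<K. m (R (Suc i)) - m (R i))"
        using K by (intro sum_strict_mono) (auto simp: not_le lessThan_empty_iff)
      also have "\<dots> = m (R K) - m (R 0)"
        by (rule sum_lessThan_telescope)
      also have "\<dots> \<le> 1"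
        using m_bounds[of "R K"] m_bounds[of "R 0"] by simp
      finally show False
        using K by simp
    qed
    then obtain i where i: "i < K" "m (R (Suc i)) - m (R i) \<le> 1 / K"
      by blast
    let ?P = "ball y (R i)" and ?Q = "- ball y (R (Suc i))"
    define p where "p = m (R i)"
    define q where "q = 1 - m (R (Suc i))"
    have pq: "0 \<le> p" "0 \<le> q" "1 - 1 / K \<le> p + q"
      using i(2) m_bounds by (auto simp: p_def q_def)
    have "ennreal (j * (measure \<mu> ?P)\<^sup>2 + j * (measure \<mu> ?Q)\<^sup>2 + 2 * (j + g / 2) * measure \<mu> ?P * measure \<mu> ?Q)
        \<le> pair_energy V \<mu>"
    proof (rule pair_energy_split[OF assms(1) V' _ _ _ inf])
      show "?P \<inter> ?Q = {}"
        using \<open>0 < L\<close> by (auto simp: R_Suc)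
      fix x z assume "x \<in> ?P" "z \<in> ?Q"
      then have "L \<le> dist x z"
        using dist_triangle[of y z x] by (auto simp: R_Suc)
      with far[of x z] far[of z x] show "ennreal (j + g / 2) \<le> V x z \<and> ennreal (j + g / 2) \<le> V z x"
        by (simp add: dist_commute)
    qed (use assms jg in auto)
    also note energy
    finally have "j * p\<^sup>2 + j * q\<^sup>2 + 2 * (j + g / 2) * p * q \<le> j + \<delta>"
      unfolding compl using assms by (subst (asm) ennreal_le_iff) (auto simp: p_def q_def m_def)
    then have "j * (p + q)\<^sup>2 + g * p * q \<le> j + \<delta>"
      by (simp add: algebra_simps power2_eq_square)
    moreover have "j * (1 - 2 / K) \<le> j * (p + q)\<^sup>2"
    proof (intro mult_left_mono)
      have "1 - 2 / K \<le> (1 - 1 / real K)\<^sup>2"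
        by (simp add: power2_eq_square algebra_simps)
      also have "\<dots> \<le> (p + q)\<^sup>2"
        using pq K by (intro power_mono) auto
      finally show "1 - 2 / K \<le> (p + q)\<^sup>2" .
    qed fact
    ultimately have "g * p * q \<le> \<delta> + 2 * j / K"
      by (simp add: algebra_simps)
    moreover have "g / (4 * (j + g / 2)) \<le> p"
      using m_ge m_mono[OF R_ge[of i]] by (simp add: p_def)
    then have "g * (g / (4 * (j + g / 2))) * q \<le> g * p * q"
      using pq \<open>0 < g\<close> by (intro mult_right_mono mult_left_mono) auto
    ultimately have "g * (g / (4 * (j + g / 2))) * q \<le> \<delta> + 2 * j / K"
      by simp
    then have "q \<le> 4 * (j + g / 2) / g\<^sup>2 * (\<delta> + 2 * j / K)"
      using jg \<open>0 < g\<close> by (simp add: field_simps power2_eq_square)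
    moreover have "measure \<mu> (- cball y (L * (real K + 1))) \<le> q"
    proof -
      have "R (Suc i) \<le> L * (real K + 1)"
        unfolding R_def using i(1) \<open>0 < L\<close> by (intro mult_left_mono) auto
      then show ?thesis
        unfolding q_def compl[symmetric] by (intro finite_measure_mono) auto
    qed
    ultimately show "measure \<mu> (- cball y (L * (real K + 1))) \<le> 4 * (j + g / 2) / g\<^sup>2 * (\<delta> + 2 * j / K)"
      by simp
  qed
qed

section \<open>Lower semicontinuity and existence of minimisers\<close>

lemma pair_energy_distr:
  assumes "sigma_finite_measure M" and [measurable]: "f \<in> measurable M N"
    and V[measurable]: "case_prod V \<in> borel_measurable (N \<Otimes>\<^sub>M N)"
  shows "pair_energy V (distr M N f) = (\<integral>\<^sup>+y. \<integral>\<^sup>+x. V (f x) (f y) \<partial>M \<partial>M)"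
proof -
  interpret sigma_finite_measure M by fact
  have [measurable]: "(\<lambda>(y, x). V x y) \<in> borel_measurable (N \<Otimes>\<^sub>M N)"
    using measurable_compose[OF measurable_pair_swap' V] by (simp add: case_prod_beta')
  have [measurable]: "(\<lambda>x. V x y) \<in> borel_measurable N" if "y \<in> space N" for y
    using measurable_compose[OF measurable_Pair1' V] that by simp
  have "pair_energy V (distr M N f) = (\<integral>\<^sup>+y. \<integral>\<^sup>+x. V (f x) y \<partial>M \<partial>distr M N f)"
    unfolding pair_energy_def by (intro nn_integral_cong nn_integral_distr) auto
  also have "\<dots> = (\<integral>\<^sup>+y. \<integral>\<^sup>+x. V (f x) (f y) \<partial>M \<partial>M)"
    by (intro nn_integral_distr) measurable
  finally show ?thesis .
qed

text \<open>
  On the common probability space of the representing random variables, lower semicontinuity of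
  the energy is just Fatou's lemma, once for each of the two integrals.
\<close>

lemma pair_energy_liminf:
  fixes V :: "'a::{second_countable_topology} \<Rightarrow> 'a \<Rightarrow> ennreal"
  assumes "prob_space M"
    and V[measurable]: "case_prod V \<in> borel_measurable (borel \<Otimes>\<^sub>M borel)"
    and lsc: "\<And>x y X Y. X \<longlonglongrightarrow> x \<Longrightarrow> Y \<longlonglongrightarrow> y \<Longrightarrow> V x y \<le> liminf (\<lambda>n. V (X n) (Y n))"
    and [measurable]: "\<And>n. X n \<in> borel_measurable M" "X\<^sub>0 \<in> borel_measurable M"
    and lim: "AE \<omega> in M. (\<lambda>n. X n \<omega>) \<longlonglongrightarrow> X\<^sub>0 \<omega>"
  shows "pair_energy V (distr M borel X\<^sub>0) \<le> liminf (\<lambda>n. pair_energy V (distr M borel (X n)))"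
proof -
  interpret prob_space M by fact
  have [measurable]: "(\<lambda>(y, x). V x y) \<in> borel_measurable (borel \<Otimes>\<^sub>M borel)"
    using measurable_compose[OF measurable_pair_swap' V] by (simp add: case_prod_beta')
  have "pair_energy V (distr M borel X\<^sub>0) = (\<integral>\<^sup>+y. \<integral>\<^sup>+x. V (X\<^sub>0 x) (X\<^sub>0 y) \<partial>M \<partial>M)"
    by (intro pair_energy_distr sigma_finite_measure_axioms) measurable
  also have "\<dots> \<le> (\<integral>\<^sup>+y. \<integral>\<^sup>+x. liminf (\<lambda>n. V (X n x) (X n y)) \<partial>M \<partial>M)"
  proof (intro nn_integral_mono_AE, rule AE_mp[OF lim], intro AE_I2 impI)
    fix y assume y: "(\<lambda>n. X n y) \<longlonglongrightarrow> X\<^sub>0 y"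
    show "(\<integral>\<^sup>+x. V (X\<^sub>0 x) (X\<^sub>0 y) \<partial>M) \<le> (\<integral>\<^sup>+x. liminf (\<lambda>n. V (X n x) (X n y)) \<partial>M)"
      by (intro nn_integral_mono_AE, rule AE_mp[OF lim], intro AE_I2 impI) (rule lsc[OF _ y])
  qed
  also have "\<dots> \<le> (\<integral>\<^sup>+y. liminf (\<lambda>n. \<integral>\<^sup>+x. V (X n x) (X n y) \<partial>M) \<partial>M)"
    by (intro nn_integral_mono nn_integral_liminf) measurable
  also have "\<dots> \<le> liminf (\<lambda>n. \<integral>\<^sup>+y. \<integral>\<^sup>+x. V (X n x) (X n y) \<partial>M \<partial>M)"
    by (intro nn_integral_liminf) measurable
  also have "\<dots> = liminf (\<lambda>n. pair_energy V (distr M borel (X n)))"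
    by (subst pair_energy_distr[OF sigma_finite_measure_axioms]) measurable
  finally show ?thesis .
qed

text \<open>
  The direct method: translating a minimising sequence so that its members concentrate around the
  origin costs no energy and makes it tight, and the energy of a limit is at most the infimum.
  The hypothesis on \<open>\<mu>bar\<close>, that the infimum lies strictly below the kernel's value \<open>C\<close> at
  infinity, provides the gap on which the concentration estimate rests.
\<close>

theorem pair_energy_minimizer_exists:
  fixes V :: "'a::euclidean_space \<Rightarrow> 'a \<Rightarrow> ennreal"
  assumes V[measurable]: "case_prod V \<in> borel_measurable (borel \<Otimes>\<^sub>M borel)"
    and lsc: "\<And>x y X Y. X \<longlonglongrightarrow> x \<Longrightarrow> Y \<longlonglongrightarrow> y \<Longrightarrow> V x y \<le> liminf (\<lambda>n. V (X n) (Y n))"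
    and transl: "\<And>x y z. V (x - z) (y - z) = V x y"
    and far: "\<And>e. e < C \<Longrightarrow> \<exists>L>0. \<forall>x y. L \<le> dist x y \<longrightarrow> ennreal e \<le> V x y"
    and \<mu>bar: "\<mu>bar \<in> borel_prob_measures" "pair_energy V \<mu>bar < ennreal C"
  shows "\<exists>\<mu>\<^sub>0\<in>borel_prob_measures. \<forall>\<mu>\<in>borel_prob_measures. pair_energy V \<mu>\<^sub>0 \<le> pair_energy V \<mu>"
proof -
  define I where "I = (INF \<mu>\<in>borel_prob_measures. pair_energy V (\<mu> :: 'a measure))"
  have I_le: "I \<le> pair_energy V \<mu>" if "\<mu> \<in> borel_prob_measures" for \<mu>
    unfolding I_def using that by (rule INF_lower)
  have "I < ennreal C"
    using I_le[OF \<mu>bar(1)] \<mu>bar(2) by simp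
  moreover define j where "j = enn2real I"
  ultimately have j: "0 \<le> j" "I = ennreal j" "j < C"
    by (cases I; auto simp: ennreal_less_iff)+
  define g where "g = C - j"
  have g: "0 < g" "j + g / 2 < C"
    using j by (auto simp: g_def field_simps)
  obtain L where L: "0 < L" "\<And>x y. L \<le> dist x y \<Longrightarrow> ennreal (j + g / 2) \<le> V x y"
    using far[OF g(2)] by blast
  \<comment> \<open>excess energies tending to 0, all within the range \<open>\<delta> < g / 4\<close> of the concentration estimate\<close>
  define \<delta> where "\<delta> n = g / 4 * inverse (real (Suc (Suc n)))" for n
  have \<delta>: "0 < \<delta> n" "\<delta> n < g / 4" for n
  proof -
    have "0 < inverse (real (Suc (Suc n)))" "inverse (real (Suc (Suc n))) < 1"
      by (simp_all add: inverse_eq_divide)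
    then show "0 < \<delta> n" "\<delta> n < g / 4"
      unfolding \<delta>_def using g(1) mult_strict_left_mono[of "inverse (real (Suc (Suc n)))" 1 "g / 4"] by simp_all
  qed
  have \<delta>_lim: "\<delta> \<longlonglongrightarrow> 0"
    unfolding \<delta>_def using LIMSEQ_Suc[OF LIMSEQ_inverse_real_of_nat] by (intro tendsto_mult_right_zero)
  have "\<exists>\<mu>\<in>borel_prob_measures. pair_energy V \<mu> < ennreal (j + \<delta> n)" for n
    using \<delta>[of n] j(1) unfolding INF_less_iff[symmetric] I_def[symmetric] j(2) by (simp add: ennreal_less_iff)
  then obtain \<mu> where \<mu>: "\<And>n. \<mu> n \<in> borel_prob_measures" "\<And>n. pair_energy V (\<mu> n) < ennreal (j + \<delta> n)"
    by metis
  have prob_\<mu>: "prob_space (\<mu> n)" and sets_\<mu>[measurable_cong]: "sets (\<mu> n) = sets borel" for n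
    using \<mu>(1) by (auto simp: borel_prob_measures_def)
  define D where "D = 4 * (j + g / 2) / g\<^sup>2"
  have D: "0 \<le> D"
    using j g by (simp add: D_def)
  have "\<exists>y. \<forall>K\<ge>1::nat. measure (\<mu> n) (- cball y (L * (real K + 1))) \<le> D * (\<delta> n + 2 * j / K)" for n
    unfolding D_def
  proof (rule near_minimizer_concentrates[OF prob_\<mu> sets_\<mu> V _ L(2) j(1) g(1) L(1) \<delta>(2)])
    show "ennreal j \<le> pair_energy V \<nu>" if "prob_space \<nu>" "sets \<nu> = sets (\<mu> n)" for \<nu>
      using I_le[of \<nu>] that by (simp add: j(2) sets_\<mu> borel_prob_measures_def)
  qed (use \<delta>(1)[of n] \<mu>(2)[of n] in auto)
  then obtain y where y: "\<And>n K. 1 \<le> K \<Longrightarrow>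
      measure (\<mu> n) (- cball (y n) (L * (real K + 1))) \<le> D * (\<delta> n + 2 * j / K)"
    by metis
  define \<nu> where "\<nu> n = distr (\<mu> n) borel (\<lambda>x. x - y n)" for n
  have prob_\<nu>: "prob_space (\<nu> n)" for n
    unfolding \<nu>_def using prob_\<mu> by (intro prob_space.prob_space_distr) auto
  have energy_\<nu>: "pair_energy V (\<nu> n) = pair_energy V (\<mu> n)" for n
    unfolding \<nu>_def
    by (subst pair_energy_distr)
       (auto simp: transl pair_energy_def prob_\<mu> prob_space_imp_sigma_finite)
  have tight: "\<exists>R. \<forall>\<^sub>F n in sequentially. measure (\<nu> n) (- cball 0 R) \<le> \<epsilon>" if "\<epsilon> > 0" for \<epsilon>
  proof -
    have "(\<lambda>K. D * (2 * j / real K)) \<longlonglongrightarrow> D * 0"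
      by (intro tendsto_mult tendsto_const lim_const_over_n)
    then have "\<forall>\<^sub>F K in sequentially. D * (2 * j / real K) < \<epsilon> / 2"
      using that by (intro order_tendstoD(2)) auto
    then obtain K where K: "1 \<le> K" "D * (2 * j / real K) < \<epsilon> / 2"
      using eventually_conj[OF eventually_ge_at_top[of 1]] eventually_happens'[OF sequentially_bot] by blast
    have "(\<lambda>n. D * \<delta> n) \<longlonglongrightarrow> D * 0"
      by (intro tendsto_mult tendsto_const \<delta>_lim)
    then have "\<forall>\<^sub>F n in sequentially. D * \<delta> n < \<epsilon> / 2"
      using that by (intro order_tendstoD(2)) auto
    then have "\<forall>\<^sub>F n in sequentially. measure (\<nu> n) (- cball 0 (L * (real K + 1))) \<le> \<epsilon>"
    proof eventually_elim
      case (elim n)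
      have "measure (\<nu> n) (- cball 0 (L * (real K + 1))) = measure (\<mu> n) (- cball (y n) (L * (real K + 1)))"
        unfolding \<nu>_def
        by (subst measure_distr)
           (auto intro!: arg_cong[where f="measure (\<mu> n)"] simp: dist_norm norm_minus_commute sets_eq_imp_space_eq[OF sets_\<mu>])
      also have "\<dots> \<le> \<epsilon>"
        using y[OF K(1), of n] elim K(2) by (simp add: distrib_left)
      finally show ?case .
    qed
    then show ?thesis by blast
  qed
  have sets_\<nu>: "sets (\<nu> n) = sets borel" for n
    by (simp add: \<nu>_def)
  obtain r :: "nat \<Rightarrow> nat" and \<Omega> :: "real measure" and X X\<^sub>0 where r: "strict_mono r" and \<Omega>: "prob_space \<Omega>"
    and X: "\<And>n. X n \<in> borel_measurable \<Omega>" "\<And>n. distr \<Omega> borel (X n) = \<nu> (r n)"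
    and X\<^sub>0: "X\<^sub>0 \<in> borel_measurable \<Omega>" "AE \<omega> in \<Omega>. (\<lambda>n. X n \<omega>) \<longlonglongrightarrow> X\<^sub>0 \<omega>"
    by (rule skorohod_euclidean[OF prob_\<nu> sets_\<nu> tight], assumption) (rule that; simp)
  have "pair_energy V (distr \<Omega> borel X\<^sub>0) \<le> liminf (\<lambda>n. pair_energy V (distr \<Omega> borel (X n)))"
    by (rule pair_energy_liminf[OF \<Omega> V lsc X(1) X\<^sub>0])
  also have "\<dots> \<le> liminf (\<lambda>n. ennreal (j + \<delta> (r n)))"
    unfolding X(2) energy_\<nu> using \<mu>(2) by (intro Liminf_mono always_eventually) (auto intro: less_imp_le)
  also have "(\<lambda>n. ennreal (j + \<delta> (r n))) \<longlonglongrightarrow> ennreal (j + 0)"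
    using LIMSEQ_subseq_LIMSEQ[OF \<delta>_lim r] by (intro tendsto_ennrealI tendsto_add tendsto_const) (simp add: comp_def)
  then have "liminf (\<lambda>n. ennreal (j + \<delta> (r n))) = ennreal (j + 0)"
    by (intro lim_imp_Liminf) auto
  finally have "pair_energy V (distr \<Omega> borel X\<^sub>0) \<le> I"
    by (simp add: j(2))
  moreover have "distr \<Omega> borel X\<^sub>0 \<in> borel_prob_measures"
    using prob_space.prob_space_distr[OF \<Omega> X\<^sub>0(1)] by (simp add: borel_prob_measures_def)
  ultimately show ?thesis
    using I_le by (blast intro: order_trans)
qed

section \<open>Thinly spread distributions\<close>

text \<open>
  The uniform distribution on a large ball does it. Cut \<open>f\<close> at a radius \<open>r\<close> beyond which it is at
  most \<open>\<epsilon> / 2\<close>; by translation invariance the part inside contributes at most its integral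
  divided by the volume of the ball, which is at least \<open>R\<close> times that of the unit ball if
  \<open>R \<ge> 1\<close>.
\<close>

lemma spread_out_energy_small:
  fixes f :: "'a::euclidean_space \<Rightarrow> ennreal"
  assumes f[measurable]: "f \<in> borel_measurable borel"
    and loc: "\<And>r. (\<integral>\<^sup>+x. f x * indicator (cball 0 r) x \<partial>lborel) < \<infinity>"
    and decay: "\<And>\<epsilon>. \<epsilon> > 0 \<Longrightarrow> \<exists>r. \<forall>x. r \<le> norm x \<longrightarrow> f x \<le> ennreal \<epsilon>"
    and "\<epsilon> > 0"
  shows "\<exists>\<mu>\<in>borel_prob_measures. pair_energy (\<lambda>x y. f (x - y)) \<mu> \<le> ennreal \<epsilon>"
proof -
  obtain r where r: "\<And>x. r \<le> norm x \<Longrightarrow> f x \<le> ennreal (\<epsilon> / 2)"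
    using decay[of "\<epsilon> / 2"] \<open>\<epsilon> > 0\<close> by auto
  define F where "F x = f x * indicator (cball 0 r) x" for x
  have [measurable]: "F \<in> borel_measurable borel"
    unfolding F_def[abs_def] by (intro borel_measurable_times_ennreal f borel_measurable_indicator) simp
  obtain a where a: "0 \<le> a" "(\<integral>\<^sup>+x. F x \<partial>lborel) = ennreal a"
    using loc[of r] unfolding F_def by (cases "\<integral>\<^sup>+x. f x * indicator (cball 0 r) x \<partial>lborel") auto
  define u where "u = measure lborel (ball (0::'a) 1)"
  have u: "u > 0"
    unfolding u_def by (rule content_ball_pos) simp
  define R where "R = max 1 (2 * a / (\<epsilon> * u))"
  have R: "1 \<le> R" "2 * a / (\<epsilon> * u) \<le> R"
    by (auto simp: R_def)
  let ?B = "ball (0::'a) R"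
  define v where "v = measure lborel ?B"
  have "R ^ 1 \<le> R ^ DIM('a)"
    using R(1) by (intro power_increasing) auto
  then have "2 * a / (\<epsilon> * u) * u \<le> R ^ DIM('a) * u"
    using R(2) u by (intro mult_right_mono) auto
  also have "\<dots> = v"
    unfolding v_def u_def using R(1) content_ball_conv_unit_ball[of R "0::'a"] by simp
  finally have v_ge: "a / v \<le> \<epsilon> / 2" and v: "0 < v"
  proof -
    show "0 < v"
      unfolding v_def using R(1) by (intro content_ball_pos) auto
    moreover assume "2 * a / (\<epsilon> * u) * u \<le> v"
    ultimately show "a / v \<le> \<epsilon> / 2"
      using u \<open>\<epsilon> > 0\<close> by (simp add: field_simps)
  qed
  have vol: "emeasure lborel ?B = ennreal v"
    unfolding v_def using emeasure_lborel_ball_finite[of "0::'a" R]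
    by (intro emeasure_eq_ennreal_measure) auto
  let ?\<mu> = "uniform_measure lborel ?B"
  interpret prob_space ?\<mu>
    using v by (intro prob_space_uniform_measure) (auto simp: vol)
  have inner: "(\<integral>\<^sup>+x. f (x - y) \<partial>?\<mu>) \<le> ennreal \<epsilon>" for y
  proof -
    have "(\<integral>\<^sup>+x. f (x - y) \<partial>?\<mu>) \<le> (\<integral>\<^sup>+x. ennreal (\<epsilon> / 2) + F (x - y) \<partial>?\<mu>)"
    proof (intro nn_integral_mono)
      fix x show "f (x - y) \<le> ennreal (\<epsilon> / 2) + F (x - y)"
        using r[of "x - y"] by (cases "norm (x - y) \<le> r") (auto simp: F_def intro: add_increasing2)
    qed
    also have "\<dots> = ennreal (\<epsilon> / 2) + (\<integral>\<^sup>+x. F (x - y) \<partial>?\<mu>)"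
      using emeasure_space_1 by (subst nn_integral_add) auto
    also have "(\<integral>\<^sup>+x. F (x - y) \<partial>?\<mu>) = (\<integral>\<^sup>+x. F (x - y) * indicator ?B x \<partial>lborel) / ennreal v"
      by (subst nn_integral_uniform_measure) (auto simp: vol)
    also have "\<dots> \<le> (\<integral>\<^sup>+x. F (x - y) \<partial>lborel) / ennreal v"
      by (intro divide_right_mono_ennreal nn_integral_mono) (auto simp: indicator_def)
    also have "(\<integral>\<^sup>+x. F (x - y) \<partial>lborel) = (\<integral>\<^sup>+x. F x \<partial>distr lborel borel ((+) (- y)))"
      by (subst nn_integral_distr) auto
    also have "\<dots> = ennreal a"
      unfolding lborel_distr_plus by (rule a(2))
    also have "ennreal a / ennreal v = ennreal (a / v)"
      using a(1) v by (rule divide_ennreal)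
    also have "ennreal (\<epsilon> / 2) + \<dots> \<le> ennreal (\<epsilon> / 2) + ennreal (\<epsilon> / 2)"
      by (intro add_left_mono ennreal_leI v_ge)
    also have "\<dots> = ennreal \<epsilon>"
      using \<open>\<epsilon> > 0\<close> by (simp flip: ennreal_plus)
    finally show ?thesis by (simp add: add_left_mono)
  qed
  have "pair_energy (\<lambda>x y. f (x - y)) ?\<mu> \<le> (\<integral>\<^sup>+y. ennreal \<epsilon> \<partial>?\<mu>)"
    unfolding pair_energy_def by (intro nn_integral_mono inner)
  also have "\<dots> = ennreal \<epsilon>"
    using emeasure_space_1 by simp
  finally show ?thesis
    using prob_space_axioms by (intro bexI[of _ ?\<mu>]) (auto simp: borel_prob_measures_def)
qed

section \<open>From signed to nonnegative kernels\<close>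

lemma less_e2ennreal_iff: "a < e2ennreal z \<longleftrightarrow> enn2ereal a < z"
proof (cases "0 \<le> z")
  case True
  then show ?thesis
    by (simp add: less_ennreal.rep_eq enn2ereal_e2ennreal)
next
  case False
  then show ?thesis
    using order_trans[OF _ enn2ereal_nonneg[of a], of z] by (simp add: e2ennreal_neg not_less)
qed

text \<open>
  Adding a constant to a function bounded below turns its integral into one of a nonnegative
  function. This rests on the pointwise identity \<open>(f + C) + f\<^sup>- = f\<^sup>+ + C\<close>, in which no
  differences occur, and on the finiteness of the integral of the negative part \<open>f\<^sup>-\<close>.
\<close>

lemma ereal_integral_eq_shifted:
  assumes "prob_space M" and [measurable]: "f \<in> borel_measurable M"
    and bound: "\<And>x. x \<in> space M \<Longrightarrow> - ereal C \<le> f x" and "0 \<le> C"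
  shows "ereal_integral M f = enn2ereal (\<integral>\<^sup>+x. e2ennreal (f x + ereal C) \<partial>M) - ereal C"
proof -
  interpret prob_space M by fact
  let ?S = "\<integral>\<^sup>+x. e2ennreal (f x + ereal C) \<partial>M" and ?P = "\<integral>\<^sup>+x. e2ennreal (f x) \<partial>M"
    and ?N = "\<integral>\<^sup>+x. e2ennreal (- f x) \<partial>M"
  have "e2ennreal (f x + ereal C) + e2ennreal (- f x) = e2ennreal (f x) + ennreal C" if "x \<in> space M" for x
  proof (cases "f x")
    case (real t)
    then show ?thesis
      using bound[OF that] \<open>0 \<le> C\<close>
      by (cases "0 \<le> t") (simp_all add: ennreal_neg flip: ennreal_plus)
  qed (use bound[OF that] in auto)
  then have "(\<integral>\<^sup>+x. e2ennreal (f x + ereal C) + e2ennreal (- f x) \<partial>M) = (\<integral>\<^sup>+x. e2ennreal (f x) + ennreal C \<partial>M)"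
    by (rule nn_integral_cong)
  then have "?S + ?N = ?P + ennreal C"
    by (simp add: nn_integral_add emeasure_space_1)
  moreover have "?N \<le> (\<integral>\<^sup>+x. ennreal C \<partial>M)"
  proof (intro nn_integral_mono)
    fix x assume "x \<in> space M"
    from bound[OF this] have "- f x \<le> ereal C"
      by (simp add: ereal_uminus_le_reorder)
    then show "e2ennreal (- f x) \<le> ennreal C"
      using e2ennreal_mono by fastforce
  qed
  then have "?N \<le> ennreal C"
    by (simp add: emeasure_space_1)
  ultimately show ?thesis
    unfolding ereal_integral_def using \<open>0 \<le> C\<close>
    by (cases ?S; cases ?P; cases ?N) (auto simp: top_unique simp flip: ennreal_plus)
qed

lemma interaction_energy_eq_pair_energy:
  fixes \<mu> :: "'a::euclidean_space measure"
  assumes "prob_space \<mu>" and sets_\<mu>[measurable_cong]: "sets \<mu> = sets borel"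
    and [measurable]: "(\<lambda>x::'a. W (norm x)) \<in> borel_measurable borel"
    and bound: "\<And>r. 0 \<le> r \<Longrightarrow> - ereal C \<le> W r" and "0 \<le> C"
  shows "interaction_energy W \<mu> = enn2ereal (pair_energy (\<lambda>x y. e2ennreal (W (norm (x - y)) + ereal C)) \<mu>) - ereal C"
proof -
  interpret prob_space \<mu> by fact
  define G where "G y = (\<integral>\<^sup>+x. e2ennreal (W (norm (x - y)) + ereal C) \<partial>\<mu>)" for y
  have [measurable]: "(\<lambda>x. W (norm (x - y))) \<in> borel_measurable borel" for y :: 'a
    using measurable_compose[of "\<lambda>x. x - y" borel borel "\<lambda>x::'a. W (norm x)"] by simp
  have W2[measurable]: "(\<lambda>p::'a \<times> 'a. W (norm (snd p - fst p))) \<in> borel_measurable (borel \<Otimes>\<^sub>M borel)"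
    using measurable_compose[of "\<lambda>p. snd p - fst p" "borel \<Otimes>\<^sub>M borel" borel "\<lambda>x::'a. W (norm x)"] by simp
  have [measurable]: "G \<in> borel_measurable borel"
    unfolding G_def[abs_def] by (intro borel_measurable_nn_integral) (simp add: case_prod_beta')
  have "ereal_integral \<mu> (\<lambda>x. W (norm (x - y))) = enn2ereal (G y) - ereal C" for y
    unfolding G_def using assms by (intro ereal_integral_eq_shifted) auto
  then have "interaction_energy W \<mu> = ereal_integral \<mu> (\<lambda>y. enn2ereal (G y) - ereal C)"
    unfolding interaction_energy_def by simp
  also have "\<dots> = enn2ereal (\<integral>\<^sup>+y. e2ennreal (enn2ereal (G y) - ereal C + ereal C) \<partial>\<mu>) - ereal C"
  proof (intro ereal_integral_eq_shifted)
    fix y show "- ereal C \<le> enn2ereal (G y) - ereal C"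
      using enn2ereal_nonneg[of "G y"] by (cases "enn2ereal (G y)") auto
  qed (use assms in auto)
  also have "(\<integral>\<^sup>+y. e2ennreal (enn2ereal (G y) - ereal C + ereal C) \<partial>\<mu>) = (\<integral>\<^sup>+y. G y \<partial>\<mu>)"
  proof (intro nn_integral_cong)
    fix y
    have "enn2ereal (G y) - ereal C + ereal C = enn2ereal (G y)"
      by (cases "enn2ereal (G y)") auto
    then show "e2ennreal (enn2ereal (G y) - ereal C + ereal C) = G y"
      by simp
  qed
  finally show ?thesis
    unfolding G_def pair_energy_def .
qed

lemma lower_semicontinuous_on_nbhd:
  assumes "lower_semicontinuous_on S f" "x \<in> S" "a < f x"
  shows "\<forall>\<^sub>F y in nhds x. y \<in> S \<longrightarrow> a < f y"
proof -
  have "a < Liminf (at x within S) f"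
    using assms by (auto simp: lower_semicontinuous_on_def intro: less_le_trans)
  then have "\<forall>\<^sub>F y in at x within S. a < f y"
    by (rule less_LiminfD)
  then show ?thesis
    unfolding eventually_at_filter using assms(3) by (auto elim!: eventually_mono)
qed

text \<open>
  Near infinity the limit bounds \<open>W\<close>; on the remaining compact interval, points where \<open>W\<close> falls
  below \<open>-n\<close> would accumulate at a point where semicontinuity forces the value \<open>-\<infinity>\<close>.
\<close>

lemma lower_semicontinuous_on_bounded_below:
  fixes W :: "real \<Rightarrow> ereal"
  assumes lsc: "lower_semicontinuous_on {0..} W"
    and fin: "\<And>r. 0 \<le> r \<Longrightarrow> W r \<noteq> - \<infinity>"
    and lim: "(W \<longlongrightarrow> 0) at_top"
  obtains C :: real where "0 < C" "\<And>r. 0 \<le> r \<Longrightarrow> - ereal C \<le> W r"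
proof -
  have "\<forall>\<^sub>F r in at_top. - 1 < W r"
    using lim by (rule order_tendstoD) simp
  then obtain r\<^sub>0 where r\<^sub>0: "\<And>r. r\<^sub>0 \<le> r \<Longrightarrow> - 1 < W r"
    by (auto simp: eventually_at_top_linorder)
  have "\<exists>n. \<forall>r\<in>{0..r\<^sub>0}. - ereal (real n) \<le> W r"
  proof (rule ccontr)
    assume "\<not> ?thesis"
    then have "\<forall>n. \<exists>r\<in>{0..r\<^sub>0}. W r < - ereal (real n)"
      by (auto simp: not_le)
    then obtain X where X: "\<And>n. X n \<in> {0..r\<^sub>0}" "\<And>n. W (X n) < - ereal (real n)"
      by metis
    obtain x s where x: "x \<in> {0..r\<^sub>0}" and s: "strict_mono s" "(X \<circ> s) \<longlonglongrightarrow> x"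
      using compact_Icc[of 0 r\<^sub>0] X(1) unfolding compact_def by meson
    obtain m :: nat where m: "- ereal (real m) < W x"
    proof (cases "W x")
      case (real t)
      obtain m :: nat where "- t < real m"
        using reals_Archimedean2 by blast
      then show ?thesis using that[of m] real by simp
    qed (use fin[of x] x that[of 0] in auto)
    have "\<forall>\<^sub>F n in sequentially. X (s n) \<in> {0..} \<longrightarrow> - ereal (real m) < W (X (s n))"
      using eventually_compose_filterlim[OF lower_semicontinuous_on_nbhd[OF lsc _ m] s(2)] x by (simp add: comp_def)
    moreover have "\<forall>\<^sub>F n in sequentially. m \<le> s n"
      using filterlim_subseq[OF s(1)] by (simp add: filterlim_at_top)
    ultimately have "\<forall>\<^sub>F n in sequentially. False"
    proof eventually_elim
      case (elim n)
      then have "- ereal (real m) < W (X (s n))"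
        using X(1)[of "s n"] by simp
      also have "\<dots> < - ereal (real (s n))"
        by (rule X(2))
      also have "\<dots> \<le> - ereal (real m)"
        using elim by simp
      finally show False by simp
    qed
    then show False by simp
  qed
  then obtain n :: nat where n: "\<And>r. r \<in> {0..r\<^sub>0} \<Longrightarrow> - ereal (real n) \<le> W r"
    by blast
  show thesis
  proof (rule that[of "real n + 1"])
    fix r :: real assume r: "0 \<le> r"
    show "- ereal (real n + 1) \<le> W r"
    proof (cases "r \<le> r\<^sub>0")
      case True
      have "- ereal (real n + 1) \<le> - ereal (real n)" by simp
      also have "\<dots> \<le> W r" using n True r by simp
      finally show ?thesis .
    next
      case False
      have "- ereal (real n + 1) \<le> - 1"
        by (simp add: one_ereal_def)
      also have "\<dots> < W r" using r\<^sub>0 False by simp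
      finally show ?thesis by simp
    qed
  qed simp
qed

section \<open>Existence of ground states\<close>

text \<open>
  With \<open>V = W + C \<ge> 0\<close>, the energy of a probability measure is its pair energy minus \<open>C\<close>, so
  nonpositive energy means pair energy at most \<open>C\<close>.
\<close>

theorem theorem3p2:
  fixes W :: "real \<Rightarrow> ereal"
  assumes "\<And>r. 0 \<le> r \<Longrightarrow> W r \<noteq> - \<infinity>"
    and "lower_semicontinuous_on {0..} W"
    and "locally_integrable (\<lambda>x::real ^ 'n. W (norm x))"
    and "(W \<longlongrightarrow> 0) at_top"
  shows "(\<exists>\<mu>\<^sub>0 \<in> borel_prob_measures :: (real ^ 'n) measure set.
            \<forall>\<mu> \<in> borel_prob_measures :: (real ^ 'n) measure set.
              interaction_energy W \<mu>\<^sub>0 \<le> interaction_energy W \<mu>)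
         \<longleftrightarrow>
         (\<exists>\<mu>bar \<in> borel_prob_measures :: (real ^ 'n) measure set. interaction_energy W \<mu>bar \<le> 0)"
proof -
  obtain C where C: "0 < C" "\<And>r. 0 \<le> r \<Longrightarrow> - ereal C \<le> W r"
    using lower_semicontinuous_on_bounded_below[OF assms(2,1,4)] by blast
  have W_lsc: "\<forall>\<^sub>F z in nhds x. a < W (norm z)" if "a < W (norm x)" for a and x :: "real ^ 'n"
  proof -
    have "\<forall>\<^sub>F z in nhds x. norm z \<in> {0..} \<longrightarrow> a < W (norm z)"
      using eventually_compose_filterlim[OF lower_semicontinuous_on_nbhd[OF assms(2) _ that]
          tendsto_norm[OF filterlim_ident]]
      by simp
    then show ?thesis by simp
  qed
  have W_meas[measurable]: "(\<lambda>x::real ^ 'n. W (norm x)) \<in> borel_measurable borel"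
  proof (rule borel_measurableI_greater)
    fix a
    have "open {x::real ^ 'n. a < W (norm x)}"
    proof (rule open_subopen[THEN iffD2], intro ballI)
      fix x :: "real ^ 'n" assume "x \<in> {x. a < W (norm x)}"
      then have "\<forall>\<^sub>F z in nhds x. a < W (norm z)"
        using W_lsc by simp
      then show "\<exists>T. open T \<and> x \<in> T \<and> T \<subseteq> {x. a < W (norm x)}"
        unfolding eventually_nhds by blast
    qed
    then show "{x \<in> space borel. a < W (norm (x::real ^ 'n))} \<in> sets borel"
      by simp
  qed
  define V where "V x y = e2ennreal (W (norm (x - y)) + ereal C)" for x y :: "real ^ 'n"
  have V_meas: "case_prod V \<in> borel_measurable (borel \<Otimes>\<^sub>M borel)"
  proof -
    have "(\<lambda>p::(real ^ 'n) \<times> (real ^ 'n). W (norm (fst p - snd p))) \<in> borel_measurable (borel \<Otimes>\<^sub>M borel)"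
      using measurable_compose[of "\<lambda>p. fst p - snd p" "borel \<Otimes>\<^sub>M borel" borel "\<lambda>x::real ^ 'n. W (norm x)"] by simp
    then show ?thesis
      unfolding V_def case_prod_beta' by measurable
  qed
  have V_lsc: "V x y \<le> liminf (\<lambda>n. V (X n) (Y n))" if "X \<longlonglongrightarrow> x" "Y \<longlonglongrightarrow> y" for X Y x y
    unfolding le_Liminf_iff
  proof (intro allI impI)
    fix a assume "a < V x y"
    have shift: "enn2ereal a < w + ereal C \<longleftrightarrow> enn2ereal a - ereal C < w" for w
      by (cases w; cases "enn2ereal a") auto
    have "enn2ereal a - ereal C < W (norm (x - y))"
      using \<open>a < V x y\<close> unfolding V_def less_e2ennreal_iff shift .
    from eventually_compose_filterlim[OF W_lsc[OF this] tendsto_diff[OF that]]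
    show "\<forall>\<^sub>F n in sequentially. a < V (X n) (Y n)"
      unfolding V_def less_e2ennreal_iff shift .
  qed
  have V_far: "\<exists>L>0. \<forall>x y. L \<le> dist x y \<longrightarrow> ennreal e \<le> V x y" if "e < C" for e
  proof -
    have "\<forall>\<^sub>F r in at_top. ereal (e - C) < W r"
      using assms(4) by (rule order_tendstoD) (use that in \<open>simp add: zero_ereal_def\<close>)
    then obtain L where L: "\<And>r. L \<le> r \<Longrightarrow> ereal (e - C) < W r"
      by (auto simp: eventually_at_top_linorder)
    have "ennreal e \<le> V x y" if "max L 1 \<le> dist x y" for x y
    proof -
      have "ereal (e - C) \<le> W (norm (x - y))"
        using L[of "norm (x - y)"] that by (simp add: dist_norm)
      then have "ereal e \<le> W (norm (x - y)) + ereal C"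
        by (cases "W (norm (x - y))") auto
      from e2ennreal_mono[OF this] show ?thesis
        by (simp add: V_def)
    qed
    then show ?thesis
      by (intro exI[of _ "max L 1"]) auto
  qed
  have energy: "interaction_energy W \<mu> = enn2ereal (pair_energy V \<mu>) - ereal C"
    if "\<mu> \<in> borel_prob_measures" for \<mu> :: "(real ^ 'n) measure"
    unfolding V_def using that C by (intro interaction_energy_eq_pair_energy W_meas) (auto simp: borel_prob_measures_def)
  have le_0_iff: "interaction_energy W \<mu> \<le> 0 \<longleftrightarrow> pair_energy V \<mu> \<le> ennreal C"
    if "\<mu> \<in> borel_prob_measures" for \<mu> :: "(real ^ 'n) measure"
    unfolding energy[OF that] using C(1) by (cases "pair_energy V \<mu>") (auto simp: top_unique)
  have le_iff: "interaction_energy W \<mu> \<le> interaction_energy W \<nu> \<longleftrightarrow> pair_energy V \<mu> \<le> pair_energy V \<nu>"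
    if "\<mu> \<in> borel_prob_measures" "\<nu> \<in> borel_prob_measures" for \<mu> \<nu> :: "(real ^ 'n) measure"
    unfolding energy[OF that(1)] energy[OF that(2)]
    by (cases "pair_energy V \<mu>"; cases "pair_energy V \<nu>") (auto simp: top_unique)
  have spread: "\<exists>\<mu>\<in>borel_prob_measures. pair_energy V \<mu> \<le> ennreal C + ennreal \<epsilon>" if \<epsilon>: "\<epsilon> > 0" for \<epsilon>
  proof -
    define f where "f x = e2ennreal \<bar>W (norm x)\<bar>" for x :: "real ^ 'n"
    have f_meas[measurable]: "f \<in> borel_measurable borel"
      unfolding f_def[abs_def] by measurable
    have loc: "(\<integral>\<^sup>+x. f x * indicator (cball 0 r) x \<partial>lborel) < \<infinity>" for r
      using assms(3) compact_cball[of 0 r] unfolding locally_integrable_def f_def nn_integral_completion by blast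
    have decay: "\<exists>r. \<forall>x. r \<le> norm x \<longrightarrow> f x \<le> ennreal \<eta>" if "\<eta> > 0" for \<eta>
    proof -
      have "\<forall>\<^sub>F r in at_top. ereal (- \<eta>) < W r" "\<forall>\<^sub>F r in at_top. W r < ereal \<eta>"
        using assms(4) that by (auto intro: order_tendstoD simp: zero_ereal_def)
      then have "\<forall>\<^sub>F r in at_top. \<bar>W r\<bar> \<le> ereal \<eta>"
      proof eventually_elim
        case (elim r)
        then show ?case by (cases "W r") auto
      qed
      then obtain R where R: "\<And>r. R \<le> r \<Longrightarrow> \<bar>W r\<bar> \<le> ereal \<eta>"
        by (auto simp: eventually_at_top_linorder)
      show ?thesis
        using e2ennreal_mono[OF R] by (auto simp: f_def)
    qed
    obtain \<mu> :: "(real ^ 'n) measure" where \<mu>: "\<mu> \<in> borel_prob_measures"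
      and small: "pair_energy (\<lambda>x y. f (x - y)) \<mu> \<le> ennreal \<epsilon>"
      using spread_out_energy_small[OF f_meas loc decay \<epsilon>] by blast
    interpret prob_space \<mu>
      using \<mu> by (simp add: borel_prob_measures_def)
    have [measurable_cong]: "sets \<mu> = sets borel"
      using \<mu> by (simp add: borel_prob_measures_def)
    have "V x y \<le> ennreal C + f (x - y)" for x y
    proof -
      have "V x y \<le> e2ennreal (ereal C + \<bar>W (norm (x - y))\<bar>)"
        unfolding V_def by (intro e2ennreal_mono) (cases "W (norm (x - y))"; auto)
      also have "\<dots> = ennreal C + f (x - y)"
        unfolding f_def using C(1) by (cases "W (norm (x - y))") auto
      finally show ?thesis .
    qed
    then have "pair_energy V \<mu> \<le> (\<integral>\<^sup>+y. \<integral>\<^sup>+x. ennreal C + f (x - y) \<partial>\<mu> \<partial>\<mu>)"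
      unfolding pair_energy_def by (intro nn_integral_mono)
    also have "\<dots> = ennreal C + pair_energy (\<lambda>x y. f (x - y)) \<mu>"
      unfolding pair_energy_def by (simp add: nn_integral_add emeasure_space_1)
    also have "\<dots> \<le> ennreal C + ennreal \<epsilon>"
      by (intro add_left_mono small)
    finally show ?thesis
      using \<mu> by blast
  qed
  have minimizer_iff: "(\<exists>\<mu>\<^sub>0 \<in> borel_prob_measures :: (real ^ 'n) measure set.
        \<forall>\<mu> \<in> borel_prob_measures :: (real ^ 'n) measure set.
          interaction_energy W \<mu>\<^sub>0 \<le> interaction_energy W \<mu>)
      \<longleftrightarrow> (\<exists>\<mu>\<^sub>0 \<in> borel_prob_measures. \<forall>\<mu> \<in> borel_prob_measures. pair_energy V \<mu>\<^sub>0 \<le> pair_energy V \<mu>)"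
    by (intro bex_cong ball_cong refl le_iff)
  have nonpos_iff: "(\<exists>\<mu>bar \<in> borel_prob_measures :: (real ^ 'n) measure set. interaction_energy W \<mu>bar \<le> 0)
      \<longleftrightarrow> (\<exists>\<mu>bar \<in> borel_prob_measures. pair_energy V \<mu>bar \<le> ennreal C)"
    by (intro bex_cong refl le_0_iff)
  show ?thesis
    unfolding minimizer_iff nonpos_iff
  proof
    assume "\<exists>\<mu>\<^sub>0 \<in> borel_prob_measures. \<forall>\<mu> \<in> borel_prob_measures. pair_energy V \<mu>\<^sub>0 \<le> pair_energy V \<mu>"
    then obtain \<mu>\<^sub>0 where \<mu>\<^sub>0: "\<mu>\<^sub>0 \<in> borel_prob_measures"
      "\<And>\<mu>. \<mu> \<in> borel_prob_measures \<Longrightarrow> pair_energy V \<mu>\<^sub>0 \<le> pair_energy V \<mu>"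
      by blast
    have "pair_energy V \<mu>\<^sub>0 \<le> ennreal C"
    proof (rule ennreal_le_epsilon)
      fix \<epsilon> :: real assume "0 < \<epsilon>"
      then obtain \<mu> where "\<mu> \<in> borel_prob_measures" "pair_energy V \<mu> \<le> ennreal C + ennreal \<epsilon>"
        using spread by blast
      with \<mu>\<^sub>0(2)[of \<mu>] show "pair_energy V \<mu>\<^sub>0 \<le> ennreal C + ennreal \<epsilon>"
        by simp
    qed
    with \<mu>\<^sub>0(1) show "\<exists>\<mu>bar \<in> borel_prob_measures. pair_energy V \<mu>bar \<le> ennreal C"
      by blast
  next
    assume "\<exists>\<mu>bar \<in> borel_prob_measures. pair_energy V \<mu>bar \<le> ennreal C"
    then obtain \<mu>bar where \<mu>bar: "\<mu>bar \<in> borel_prob_measures" "pair_energy V \<mu>bar \<le> ennreal C"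
      by blast
    show "\<exists>\<mu>\<^sub>0\<in>borel_prob_measures. \<forall>\<mu>\<in>borel_prob_measures. pair_energy V \<mu>\<^sub>0 \<le> pair_energy V \<mu>"
    proof (cases "\<exists>\<mu>\<in>borel_prob_measures. pair_energy V \<mu> < ennreal C")
      case True
      then obtain \<mu> where \<mu>: "\<mu> \<in> borel_prob_measures" "pair_energy V \<mu> < ennreal C"
        by blast
      show ?thesis
        by (rule pair_energy_minimizer_exists[OF V_meas V_lsc _ V_far \<mu>]) (simp_all add: V_def)
    next
      case False
      \<comment> \<open>then the infimum is exactly \<open>C\<close>, and \<open>\<mu>bar\<close> attains it\<close>
      then have "pair_energy V \<mu>bar \<le> pair_energy V \<mu>" if "\<mu> \<in> borel_prob_measures" for \<mu>
        using \<mu>bar(2) that by (meson linorder_not_less order_trans)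
      with \<mu>bar(1) show ?thesis
        by blast
    qed
  qed
qed

end
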